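(* Let $0<p<1$ and let $X_1,X_2$ be independent and identically distributed discrete random variables. For any positive integer $\alpha$, the conditional distribution $P(X_1=x\mid X_2\le \alpha X_1)$ is the skewed geometric distribution $SG(p,\alpha)$, i.e. $$P(X_1=x\mid X_2\le \alpha X_1)=\frac{(1-p)\,p^x\,(1-p^{\alpha x+1})(1-p^{\alpha+1})}{1-p^{\alpha+1}-p(1-p)},\qquad x=0,1,2,\ldots,$$ if, and only if, $X_1$ and $X_2$ are geometric random variables with parameter $p$, i.e. $P(X_1=x)=P(X_2=x)=(1-p)p^x$ for $x=0,1,2,\ldots$. (The equivalence is asserted for each given positive integer $\alpha$.)
   Context: For $0<p<1$ and $\alpha>0$, the skewed geometric distribution $SG(p,\alpha)$ is the probability distribution on $\{0,1,2,\ldots\}$ with probability mass function $P_X(x)=\dfrac{(1-p)p^x(1-p^{\alpha x+1})(1-p^{\alpha+1})}{1-p^{\alpha+1}-p(1-p)}$, $x=0,1,2,\ldots$.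
   Formalization: The discrete random variables are taken to have values in {0,1,2,...}; if negative values were allowed, the "only if" direction would fail for every α ≥ 2 (e.g. with an atom at −1). *)

theory Defs
  imports "HOL-Probability.Probability"
begin

definition skewed_geometric_mass :: "real \<Rightarrow> real \<Rightarrow> nat \<Rightarrow> real" where
  "skewed_geometric_mass p \<alpha> x =
     (1 - p) * p ^ x * (1 - p powr (\<alpha> * real x + 1)) * (1 - p powr (\<alpha> + 1))
       / (1 - p powr (\<alpha> + 1) - p * (1 - p))"

lemma skewed_geometric_mass_of_nat:
  assumes "0 < p"
  shows "skewed_geometric_mass p (real a) x =
     (1 - p) * p ^ x * (1 - p ^ (a * x + 1)) * (1 - p ^ (a + 1))
       / (1 - p ^ (a + 1) - p * (1 - p))"
proof -
  have "p powr (real a * real x + 1) = p ^ (a * x + 1)"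
    using assms powr_realpow[of p "a * x + 1"] by (simp add: add.commute)
  moreover have "p powr (real a + 1) = p ^ (a + 1)"
    using assms powr_realpow[of p "a + 1"] by (simp add: add.commute)
  ultimately show ?thesis
    by (simp only: skewed_geometric_mass_def)
qed

lemma skewed_geometric_mass_denom_pos:
  fixes p \<alpha> :: real
  assumes "0 < p" "p < 1" "0 < \<alpha>"
  shows "0 < 1 - p powr (\<alpha> + 1) - p * (1 - p)"
proof -
  have "p powr (\<alpha> + 1) < p powr 1"
    using assms powr_less_mono'[of p 1 "\<alpha> + 1"] by simp
  moreover have "p * (1 - p) < 1 - p"
    using assms by simp
  moreover have "p powr 1 = p"
    using assms by simp
  ultimately show ?thesis
    by argo
qed

lemma skewed_geometric_mass_nonneg:
  assumes "0 < p" "p < 1" "0 < \<alpha>"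
  shows "0 \<le> skewed_geometric_mass p \<alpha> x"
proof -
  have "p powr y \<le> 1" if "0 \<le> y" for y
    using assms that by (intro powr_le1) auto
  then show ?thesis
    using assms skewed_geometric_mass_denom_pos[OF assms]
    unfolding skewed_geometric_mass_def
    by (intro divide_nonneg_pos mult_nonneg_nonneg) auto
qed

lemma skewed_geometric_mass_sums:
  assumes "0 < p" "p < 1" "0 < \<alpha>"
  shows "skewed_geometric_mass p \<alpha> sums 1"
proof -
  define r where "r = p powr (\<alpha> + 1)"
  define D where "D = 1 - r - p * (1 - p)"
  have D: "D > 0"
    using skewed_geometric_mass_denom_pos[OF assms] by (simp add: D_def r_def)
  have r: "0 < r" "r < 1"
    using assms powr_less_mono'[of p 0 "\<alpha> + 1"] by (auto simp: r_def)
  have eq: "p ^ x * (1 - p powr (\<alpha> * real x + 1)) = p ^ x - p * r ^ x" for x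
  proof -
    have "p ^ x * p powr (\<alpha> * real x + 1) = p powr (real x + (\<alpha> * real x + 1))"
      using assms by (simp add: powr_add powr_realpow)
    also have "\<dots> = p powr ((\<alpha> + 1) * real x + 1)"
      by (simp add: algebra_simps)
    also have "\<dots> = p * r ^ x"
      using assms r by (simp add: r_def powr_add powr_powr[symmetric] powr_realpow)
    finally show ?thesis by (simp add: algebra_simps)
  qed
  have "(\<lambda>x. (1 - p) * (1 - r) / D * (p ^ x - p * r ^ x))
          sums ((1 - p) * (1 - r) / D * (1 / (1 - p) - p * (1 / (1 - r))))"
    using assms r by (intro sums_mult sums_diff geometric_sums) auto
  also have "(1 - p) * (1 - r) / D * (1 / (1 - p) - p * (1 / (1 - r))) = 1"
  proof -
    have "(1 - p) * (1 - r) * (1 / (1 - p) - p * (1 / (1 - r))) = D"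
    proof -
      have "u * v * (1 / u - p * (1 / v)) = v - p * u" if "u \<noteq> 0" "v \<noteq> 0" for u v :: real
        using that by (simp add: right_diff_distrib)
      from this[of "1 - p" "1 - r"] show ?thesis
        using assms r by (simp add: D_def)
    qed
    then show ?thesis using D by simp
  qed
  also have "(\<lambda>x. (1 - p) * (1 - r) / D * (p ^ x - p * r ^ x)) = skewed_geometric_mass p \<alpha>"
    by (rule ext) (simp add: skewed_geometric_mass_def D_def eq[symmetric] flip: r_def)
  finally show ?thesis .
qed

end

theory Submission
  imports Defs
begin

text \<open>
  Write \<open>f\<close> for the common mass function, \<open>g\<close> for the geometric one, \<open>F\<close>, \<open>G\<close> for their partial
  sums. By independence the left-hand side says \<open>f x * F (\<alpha> * x) = l * g x * G (\<alpha> * x)\<close> for a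
  constant \<open>l > 0\<close>; at \<open>x = 0\<close> this gives \<open>f 0 = \<mu> * g 0\<close> with \<open>\<mu> = sqrt l\<close>. Let \<open>B\<close> be the
  supremum of \<open>f / g\<close>. Since \<open>F / G\<close> averages \<open>f / g\<close> and always gives index \<open>0\<close> weight at
  least \<open>g 0\<close>, it is bounded by \<open>B' = B - g 0 * (B - \<mu>)\<close>. Hence \<open>f / g \<ge> l / B'\<close>, so
  \<open>F / G \<ge> l / B'\<close> and \<open>f / g \<le> B'\<close>. Thus \<open>B \<le> B'\<close>, which forces \<open>B = \<mu>\<close>, and then
  \<open>f \<le> \<mu> * g\<close> and \<open>f / g \<ge> l / B' = \<mu>\<close>. Normalisation gives \<open>\<mu> = 1\<close>.
\<close>

lemma proportional_if_mult_sum_proportional: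
  fixes f g :: "nat \<Rightarrow> real" and \<phi> :: "nat \<Rightarrow> nat"
  assumes f0: "\<And>x. 0 \<le> f x" and g0: "\<And>x. 0 < g x" and G1: "\<And>n. sum g {..n} \<le> 1"
    and l: "0 < l" and \<phi>: "\<phi> 0 = 0"
    and eq: "\<And>x. f x * sum f {..\<phi> x} = l * (g x * sum g {..\<phi> x})"
  shows "f x = sqrt l * g x"
proof -
  define \<mu> where "\<mu> = sqrt l"
  have \<mu>: "0 < \<mu>" "\<mu> * \<mu> = l"
    using l by (auto simp: \<mu>_def)
  have Gpos: "0 < sum g {..n}" for n
    using g0 by (intro sum_pos) auto
  have "0 < l * (g x * sum g {..\<phi> x})" for x
    using l g0 Gpos by simp
  then have fpos: "0 < f x" for x
    using eq[of x] f0[of x] by (cases "f x = 0") (auto simp: less_le)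
  \<comment> \<open>At index \<open>0\<close> both partial sums shrink to their single term, because
    \<open>\<phi> 0 = 0\<close>.\<close>
  have "(f 0)\<^sup>2 = (\<mu> * g 0)\<^sup>2"
    using eq[of 0] by (simp add: \<phi> power2_eq_square mult_ac flip: \<mu>(2))
  then have f_0: "f 0 = \<mu> * g 0"
    using \<mu> g0[of 0] f0[of 0] by (simp add: power2_eq_iff_nonneg)

  have lower: "l / c * g x \<le> f x" if "0 < c" "\<And>n. sum f {..n} \<le> c * sum g {..n}" for c x
  proof -
    have "l * g x * sum g {..\<phi> x} \<le> f x * c * sum g {..\<phi> x}"
      using mult_left_mono[OF that(2)[of "\<phi> x"] f0[of x]] eq[of x] by (simp add: mult_ac)
    then have "l * g x \<le> f x * c"
      using Gpos[of "\<phi> x"] by simp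
    then show ?thesis
      using that(1) by (simp add: field_simps)
  qed
  have upper: "f x \<le> l / c * g x" if "0 < c" "\<And>n. c * sum g {..n} \<le> sum f {..n}" for c x
  proof -
    have "f x * c * sum g {..\<phi> x} \<le> l * g x * sum g {..\<phi> x}"
      using mult_left_mono[OF that(2)[of "\<phi> x"] f0[of x]] eq[of x] by (simp add: mult_ac)
    then have "f x * c \<le> l * g x"
      using Gpos[of "\<phi> x"] by simp
    then show ?thesis
      using that(1) by (simp add: field_simps)
  qed
  \<comment> \<open>\<open>lower\<close> followed by summation, then \<open>upper\<close> with
    \<open>l / c\<close>, returns the same constant: a bound on partial sums becomes a pointwise
    bound.\<close>
  have improve: "f x \<le> c * g x" if "0 < c" "\<And>n. sum f {..n} \<le> c * sum g {..n}" for c x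
  proof -
    have "l / c * sum g {..n} \<le> sum f {..n}" for n
      using lower[OF that] by (auto simp: sum_distrib_left intro: sum_mono)
    then have "f x \<le> l / (l / c) * g x"
      using that l by (intro upper) auto
    then show ?thesis using l that(1) by simp
  qed

  \<comment> \<open>A crude bound whose purpose is to make the supremum of \<open>f / g\<close>
    finite.\<close>
  have "f 0 * sum g {..n} \<le> sum f {..n}" for n
  proof -
    have "f 0 * sum g {..n} \<le> f 0 * 1"
      using G1 f0 by (intro mult_left_mono)
    also have "\<dots> = sum f {0}" by simp
    also have "\<dots> \<le> sum f {..n}"
      using f0 by (intro sum_mono2) auto
    finally show ?thesis .
  qed
  then have "f x \<le> l / f 0 * g x" for x
    using fpos by (intro upper) auto
  then have bdd: "bdd_above (range (\<lambda>x. f x / g x))"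
    using g0 by (intro bdd_aboveI[of _ "l / f 0"]) (auto simp: divide_le_eq)
  define B where "B = (SUP x. f x / g x)"
  have fB: "f x \<le> B * g x" for x
    using cSUP_upper[OF UNIV_I bdd, of x] g0[of x] by (simp add: B_def divide_le_eq)
  have "\<mu> \<le> B"
    using fB[of 0] g0[of 0] by (simp add: f_0)
  have g01: "g 0 \<le> 1" using G1[of 0] by simp
  define B' where "B' = B - g 0 * (B - \<mu>)"
  \<comment> \<open>As a convex combination of \<open>B\<close> and \<open>\<mu>\<close> with
    positive weight on \<open>\<mu>\<close>, \<open>B'\<close> is positive.\<close>
  have "B' = (1 - g 0) * B + g 0 * \<mu>"
    by (simp add: B'_def algebra_simps)
  then have "0 < B'"
    using g01 \<mu>(1) \<open>\<mu> \<le> B\<close> g0[of 0] by (simp add: add_nonneg_pos)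
  have "sum f {..n} \<le> B' * sum g {..n}" for n
  proof -
    have "sum f {..n} = f 0 + sum f ({..n} - {0})"
      by (simp add: sum.remove[of _ 0])
    also have "\<dots> \<le> \<mu> * g 0 + (\<Sum>k\<in>{..n} - {0}. B * g k)"
      using fB by (intro add_mono sum_mono) (auto simp: f_0)
    also have "\<dots> = B * sum g {..n} - g 0 * (B - \<mu>)"
      by (simp add: sum.remove[of "{..n}" 0] sum_distrib_left algebra_simps)
    \<comment> \<open>The gain at index \<open>0\<close> is turned into a multiple of the partial
      sum, which is at most \<open>1\<close>.\<close>
    also have "\<dots> \<le> B * sum g {..n} - g 0 * (B - \<mu>) * sum g {..n}"
      using mult_left_mono[OF G1[of n], of "g 0 * (B - \<mu>)"] g0[of 0] \<open>\<mu> \<le> B\<close> by simp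
    finally show ?thesis by (simp add: B'_def algebra_simps)
  qed
  from improve[OF \<open>0 < B'\<close> this] have "B \<le> B'"
    unfolding B_def using g0 by (intro cSUP_least) (auto simp: divide_le_eq)
  then have "g 0 * (B - \<mu>) \<le> 0" by (simp add: B'_def)
  then have "B = \<mu>"
    using g0[of 0] \<open>\<mu> \<le> B\<close> by (simp add: mult_le_0_iff)
  have "sum f {..n} \<le> \<mu> * sum g {..n}" for n
    using fB \<open>B = \<mu>\<close> by (auto simp: sum_distrib_left intro: sum_mono)
  \<comment> \<open>The value \<open>\<mu>\<close> is the fixed point of
    \<open>c \<mapsto> l / c\<close>, so the lower bound meets the upper one.\<close>
  from lower[OF \<mu>(1) this, of x] have "\<mu> * g x \<le> f x"
    using \<mu>(1) by (simp flip: \<mu>(2))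
  with fB[of x] \<open>B = \<mu>\<close> show ?thesis by (simp add: \<mu>_def)
qed

text \<open>Countable additivity over the disjoint fibers of \<open>X\<close>. It serves twice: for
  the total mass of \<open>X1\<close> and for the probability of the conditioning event.\<close>

lemma (in finite_measure) measure_sums_fibers:
  fixes X :: "'a \<Rightarrow> nat"
  assumes [measurable]: "X \<in> measurable M (count_space UNIV)" "Measurable.pred M P"
  shows "(\<lambda>x. measure M {\<omega> \<in> space M. X \<omega> = x \<and> P \<omega>}) sums measure M {\<omega> \<in> space M. P \<omega>}"
proof -
  have "{\<omega> \<in> space M. X \<omega> = x \<and> P \<omega>} \<in> sets M" for x
    by measurable
  then have "(\<lambda>x. measure M {\<omega> \<in> space M. X \<omega> = x \<and> P \<omega>})
      sums measure M (\<Union>x. {\<omega> \<in> space M. X \<omega> = x \<and> P \<omega>})"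
    by (intro finite_measure_UNION) (auto simp: disjoint_family_on_def)
  also have "(\<Union>x. {\<omega> \<in> space M. X \<omega> = x \<and> P \<omega>}) = {\<omega> \<in> space M. P \<omega>}"
    by auto
  finally show ?thesis .
qed

lemma (in finite_measure) measure_le_eq_sum:
  fixes X :: "'a \<Rightarrow> nat"
  assumes X: "X \<in> measurable M (count_space UNIV)"
  shows "measure M {\<omega> \<in> space M. X \<omega> \<le> n} = (\<Sum>k\<le>n. measure M {\<omega> \<in> space M. X \<omega> = k})"
proof -
  have "{\<omega> \<in> space M. X \<omega> \<le> n} = (\<Union>k\<le>n. {\<omega> \<in> space M. X \<omega> = k})" by auto
  also have "measure M \<dots> = (\<Sum>k\<le>n. measure M {\<omega> \<in> space M. X \<omega> = k})"
    using X by (intro finite_measure_finite_Union) (auto simp: disjoint_family_on_def)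
  finally show ?thesis .
qed

lemma sum_geometric_mass:
  fixes p :: real
  shows "(\<Sum>k\<le>n. (1 - p) * p ^ k) = 1 - p ^ (n + 1)"
  by (induction n) (auto simp: algebra_simps)

theorem theorem1:
  fixes M :: "'a measure" and X1 X2 :: "'a \<Rightarrow> nat" and p :: real and \<alpha> :: nat
  assumes "prob_space M"
    and "0 < p" and "p < 1"
    and "\<alpha> > 0"
    and "prob_space.indep_var M (count_space UNIV) X1 (count_space UNIV) X2"
    and "distr M (count_space UNIV) X1 = distr M (count_space UNIV) X2"
  shows "(\<forall>x. \<P>(\<omega> in M. X1 \<omega> = x \<bar> X2 \<omega> \<le> \<alpha> * X1 \<omega>)
              = skewed_geometric_mass p (real \<alpha>) x)
     \<longleftrightarrow> (\<forall>x. \<P>(\<omega> in M. X1 \<omega> = x) = (1 - p) * p ^ x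
            \<and> \<P>(\<omega> in M. X2 \<omega> = x) = (1 - p) * p ^ x)"
proof -
  interpret prob_space M by fact
  have X1[measurable]: "X1 \<in> measurable M (count_space UNIV)"
    using indep_var_rv1[OF assms(5)] .
  have X2[measurable]: "X2 \<in> measurable M (count_space UNIV)"
    using indep_var_rv2[OF assms(5)] .
  define f where "f x = \<P>(\<omega> in M. X1 \<omega> = x)" for x
  define g where "g x = (1 - p) * p ^ x" for x
  define c where "c = \<P>(\<omega> in M. X2 \<omega> \<le> \<alpha> * X1 \<omega>)"
  \<comment> \<open>\<open>K\<close> is what remains of the skewed mass after splitting off
    \<open>g x\<close> and the partial sum \<open>1 - p ^ (\<alpha> * x + 1)\<close> of
    \<open>g\<close>.\<close>
  define K where "K = (1 - p ^ (\<alpha> + 1)) / (1 - p ^ (\<alpha> + 1) - p * (1 - p))"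
  have f_X2: "\<P>(\<omega> in M. X2 \<omega> = x) = f x" for x
  proof -
    have "\<P>(\<omega> in M. X2 \<omega> = x) = measure (distr M (count_space UNIV) X2) {x}"
      by (subst measure_distr) (auto intro!: arg_cong[of _ _ "measure M"])
    also have "\<dots> = f x"
      unfolding f_def assms(6)[symmetric]
      by (subst measure_distr) (auto intro!: arg_cong[of _ _ "measure M"])
    finally show ?thesis .
  qed
  have joint: "\<P>(\<omega> in M. X1 \<omega> = x \<and> X2 \<omega> \<le> \<alpha> * X1 \<omega>) = f x * sum f {..\<alpha> * x}" for x
  proof -
    have "\<P>(\<omega> in M. X1 \<omega> = x \<and> X2 \<omega> \<le> \<alpha> * X1 \<omega>)
        = \<P>(\<omega> in M. X1 \<omega> \<in> {x} \<and> X2 \<omega> \<in> {..\<alpha> * x})"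
      by (intro arg_cong[of _ _ "measure M"]) auto
    also have "\<dots> = \<P>(\<omega> in M. X1 \<omega> \<in> {x}) * \<P>(\<omega> in M. X2 \<omega> \<in> {..\<alpha> * x})"
      using indep_varD[OF assms(5), of "{x}" "{..\<alpha> * x}"]
      by (simp add: vimage_def Int_def conj_commute)
    finally show ?thesis
      by (simp add: f_def[symmetric] measure_le_eq_sum[OF X2] f_X2)
  qed
  \<comment> \<open>This also covers \<open>c = 0\<close>, where both sides take the default value
    \<open>0\<close> of division by zero.\<close>
  have cond: "\<P>(\<omega> in M. X1 \<omega> = x \<bar> X2 \<omega> \<le> \<alpha> * X1 \<omega>) = f x * sum f {..\<alpha> * x} / c" for x
    by (simp add: cond_prob_def joint c_def)
  have c_sums: "(\<lambda>x. f x * sum f {..\<alpha> * x}) sums c"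
  proof -
    \<comment> \<open>For each of the countably many values of \<open>X1\<close> the condition
      involves \<open>X2\<close> alone.\<close>
    have "Measurable.pred M (\<lambda>\<omega>. X2 \<omega> \<le> \<alpha> * X1 \<omega>)"
      by (rule measurable_compose_countable[OF _ X1]) measurable
    from measure_sums_fibers[OF X1 this] show ?thesis
      by (simp add: joint c_def)
  qed
  have f_sums: "f sums 1"
    using measure_sums_fibers[OF X1, of "\<lambda>_. True"] by (simp add: f_def[abs_def] prob_space)
  have g_sums: "g sums 1"
    using sums_mult[OF geometric_sums[of p], of "1 - p"] assms(2,3) by (simp add: g_def[abs_def])
  have sum_g: "sum g {..n} = 1 - p ^ (n + 1)" for n
    unfolding g_def by (rule sum_geometric_mass)
  have "0 < K"
  proof -
    have "p powr (real \<alpha> + 1) = p ^ (\<alpha> + 1)"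
      using assms(2) powr_realpow[of p "\<alpha> + 1"] by (simp add: add.commute)
    moreover have "p ^ (\<alpha> + 1) < 1"
      using assms(2,3) power_Suc_less_one[of p \<alpha>] by simp
    ultimately show ?thesis
      using skewed_geometric_mass_denom_pos[of p "real \<alpha>"] assms(2-4) by (simp add: K_def)
  qed
  have skewed: "skewed_geometric_mass p (real \<alpha>) x = K * (g x * sum g {..\<alpha> * x})" for x
    unfolding skewed_geometric_mass_of_nat[OF assms(2)] sum_g by (simp add: g_def K_def)
  have skewed_sums: "(\<lambda>x. K * (g x * sum g {..\<alpha> * x})) sums 1"
    using skewed_geometric_mass_sums[of p "real \<alpha>"] assms(2-4) by (simp add: skewed[abs_def])
  show ?thesis
  proof
    assume "\<forall>x. \<P>(\<omega> in M. X1 \<omega> = x \<bar> X2 \<omega> \<le> \<alpha> * X1 \<omega>)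
        = skewed_geometric_mass p (real \<alpha>) x"
    then have eq: "f x * sum f {..\<alpha> * x} / c = K * (g x * sum g {..\<alpha> * x})" for x
      by (simp add: cond skewed)
    \<comment> \<open>Otherwise every conditional probability would be \<open>0\<close>, while the
      skewed masses sum to \<open>1\<close>.\<close>
    have "c \<noteq> 0"
    proof
      assume "c = 0"
      then have "(\<lambda>_. 0 :: real) sums 1"
        using skewed_sums by (simp flip: eq)
      from sums_unique2[OF sums_zero this] show False by simp
    qed
    then have "0 < c" by (simp add: c_def less_le)
    have f: "f x = sqrt (c * K) * g x" for x
    proof (rule proportional_if_mult_sum_proportional[where \<phi> = "\<lambda>x. \<alpha> * x"])
      show "f x * sum f {..\<alpha> * x} = c * K * (g x * sum g {..\<alpha> * x})" for x
        using eq[of x] \<open>0 < c\<close> by (simp add: field_simps)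
    qed (use assms(2,3) \<open>0 < c\<close> \<open>0 < K\<close> in \<open>auto simp: f_def g_def sum_geometric_mass\<close>)
    \<comment> \<open>Both \<open>f\<close> and \<open>g\<close> have total mass \<open>1\<close>,
      which fixes the proportionality factor.\<close>
    have "f sums (sqrt (c * K) * 1)"
      unfolding f[abs_def] by (intro sums_mult g_sums)
    from sums_unique2[OF this f_sums] have "sqrt (c * K) = 1" by simp
    then show "\<forall>x. \<P>(\<omega> in M. X1 \<omega> = x) = (1 - p) * p ^ x
        \<and> \<P>(\<omega> in M. X2 \<omega> = x) = (1 - p) * p ^ x"
      unfolding f_X2 using f by (simp add: f_def g_def)
  next
    assume "\<forall>x. \<P>(\<omega> in M. X1 \<omega> = x) = (1 - p) * p ^ x
        \<and> \<P>(\<omega> in M. X2 \<omega> = x) = (1 - p) * p ^ x"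
    then have "f = g" by (auto simp: f_def g_def)
    \<comment> \<open>Comparing the two normalisations identifies \<open>c\<close> without
      evaluating its series.\<close>
    then have "K * c = 1"
      using sums_unique2[OF sums_mult[OF c_sums, of K]] skewed_sums by simp
    then have "K = 1 / c" by (cases "c = 0") (auto simp: eq_divide_eq)
    then show "\<forall>x. \<P>(\<omega> in M. X1 \<omega> = x \<bar> X2 \<omega> \<le> \<alpha> * X1 \<omega>)
        = skewed_geometric_mass p (real \<alpha>) x"
      by (simp add: cond skewed \<open>f = g\<close>)
  qed
qed

end
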